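(* Let $\{R_n : n\ge 0\}$ be the positive sequence of MC-radii (for MC $n$) and LUBORs (for non-MC $n$), i.e. $R_n$ is the MC-radius of $n$ if $n$ is MC and the LUBOR of $n$ if $n$ is non-MC. Then: (1) $\{R_n : n\ge 0\}$ is a non-decreasing sequence. (2) Suppose $k<\ell$ are two consecutive MC numbers and $n$ is non-MC such that $k<n<\ell$. Then $R_n=R_k$, namely, $R_k$ is the LUBOR for all such non-MC $n$ immediately following $k$. (3) Suppose $k<n$, $k$ is an MC number and all the numbers between $k$ and $n$ (exclusive) are non-MC. Then the radius of the largest $n$-enclosing lattice circle is strictly smaller than $R_k$ if and only if $n$ is non-MC.
   Context: A lattice point is a point of the $xy$-plane with integer coordinates. A circle is the 1-dimensional boundary curve of a disk. A circle encloses a point if the point lies in its interior (points on the circumference are not enclosed). For a nonnegative integer $n$, a circle (with arbitrary real center) is $n$-enclosing if it encloses exactly $n$ lattice points. A nonnegative integer $n$ is MC (maximally circlable) if among all $n$-enclosing circles there is one of largest radius; this largest radius is called the MC-radius of $n$. Otherwise $n$ is non-MC, and the LUBOR of $n$ is the least upper bound of the radii of all $n$-enclosing circles. Two MC numbers $k<\ell$ are consecutive if no integer strictly between them is MC. A lattice circle is a circle with at least three lattice points on its circumference.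
   Formalization: In (3), if there is no n-enclosing lattice circle (as happens for n = 6), the radius of the largest n-enclosing lattice circle is taken to be 0, so that it counts as strictly smaller than R_k. *)

theory Defs
  imports "HOL-Analysis.Analysis"
begin

(* Distances in the product type real * real are Euclidean. *)
definition lattice_points :: "(real \<times> real) set" where
  "lattice_points = \<int> \<times> \<int>"

(* A circle is given by its center c and its radius r > 0.
   The sets counted below are always finite, since the lattice meets every bounded set
   in a finite set, so card is never applied to an infinite set. *)
definition n_enclosing :: "nat \<Rightarrow> real \<times> real \<Rightarrow> real \<Rightarrow> bool" where
  "n_enclosing n c r \<longleftrightarrow> r > 0 \<and> card (lattice_points \<inter> ball c r) = n"

definition lattice_circle :: "real \<times> real \<Rightarrow> real \<Rightarrow> bool" where
  "lattice_circle c r \<longleftrightarrow> r > 0 \<and> card (lattice_points \<inter> sphere c r) \<ge> 3"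

definition enclosing_radii :: "nat \<Rightarrow> real set" where
  "enclosing_radii n = {r. \<exists>c. n_enclosing n c r}"

definition MC :: "nat \<Rightarrow> bool" where
  "MC n \<longleftrightarrow> (\<exists>r \<in> enclosing_radii n. \<forall>s \<in> enclosing_radii n. s \<le> r)"

definition MC_radius :: "nat \<Rightarrow> real" where
  "MC_radius n = (GREATEST r. r \<in> enclosing_radii n)"

definition LUBOR :: "nat \<Rightarrow> real" where
  "LUBOR n = Sup (enclosing_radii n)"

definition R :: "nat \<Rightarrow> real" where
  "R n = (if MC n then MC_radius n else LUBOR n)"

definition consecutive_MC :: "nat \<Rightarrow> nat \<Rightarrow> bool" where
  "consecutive_MC k l \<longleftrightarrow> MC k \<and> MC l \<and> k < l \<and> (\<forall>m. k < m \<and> m < l \<longrightarrow> \<not> MC m)"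

definition lattice_circle_radii :: "nat \<Rightarrow> real set" where
  "lattice_circle_radii n = {r. \<exists>c. n_enclosing n c r \<and> lattice_circle c r}"

(* The set of radii can be empty: no lattice circle encloses exactly 6 lattice points. The
   value is then 0, so that it counts as smaller than every positive radius. A nonempty set
   of radii has a greatest element: the radii are bounded, and below any bound only finitely
   many numbers are radii of lattice circles. *)
definition largest_lattice_circle_radius :: "nat \<Rightarrow> real" where
  "largest_lattice_circle_radius n =
     (if lattice_circle_radii n = {} then 0 else (GREATEST r. r \<in> lattice_circle_radii n))"

end

theory Submission imports Defs begin

text \<open>
  In both cases \<open>R n\<close> is the supremum of the \<open>n\<close>-enclosing radii.  An \<open>n\<close>-enclosing circle can
  be shrunk slightly and recentred at a point with distinct distances to all lattice points; growing
  it then admits one further lattice point at a time, so \<open>R\<close> is monotone.  Modulo lattice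
  translations the centres lie in a compact square, and a limit of \<open>n\<close>-enclosing circles whose radii
  tend to \<open>R n\<close> encloses \<open>m \<le> n\<close> points; if \<open>n\<close> is non-MC then \<open>m < n\<close>, whence
  \<open>R n = R (n - 1)\<close>.  Finally, an \<open>n\<close>-enclosing circle with at most two lattice points on its
  circumference can be enlarged by moving its centre along the bisector of these points, so a
  circle realising an MC-radius is a lattice circle.
\<close>

section \<open>Local finiteness of the lattice and translation invariance\<close>

lemma finite_lattice_cball: "finite (lattice_points \<inter> cball c r)"
proof -
  obtain a b where c: "c = (a, b)" by (cases c)
  let ?A = "{k::real. k \<in> \<int> \<and> \<bar>k\<bar> \<le> \<bar>a\<bar> + \<bar>r\<bar>}" and ?B = "{k::real. k \<in> \<int> \<and> \<bar>k\<bar> \<le> \<bar>b\<bar> + \<bar>r\<bar>}"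
  have "lattice_points \<inter> cball c r \<subseteq> ?A \<times> ?B"
  proof
    fix x assume x: "x \<in> lattice_points \<inter> cball c r"
    obtain y z where yz: "x = (y, z)" by (cases x)
    have "dist a y \<le> dist c x" "dist b z \<le> dist c x"
      using dist_fst_le[of c x] dist_snd_le[of c x] by (simp_all add: c yz)
    then show "x \<in> ?A \<times> ?B"
      using x by (auto simp: yz lattice_points_def dist_real_def)
  qed
  moreover have "finite (?A \<times> ?B)"
    by (intro finite_cartesian_product finite_abs_int_segment)
  ultimately show ?thesis by (rule finite_subset)
qed

lemma finite_lattice_ball: "finite (lattice_points \<inter> ball c r)"
  by (rule finite_subset[OF _ finite_lattice_cball[of c r]]) auto

lemma finite_lattice_sphere: "finite (lattice_points \<inter> sphere c r)"
  by (rule finite_subset[OF _ finite_lattice_cball[of c r]]) auto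

text \<open>Near radius \<open>r\<close> only finitely many lattice distances occur, so they cannot
  accumulate at \<open>r\<close>. The gap \<open>d\<close> is the room within which centre and
  radius can be perturbed while controlling which points are enclosed.\<close>

lemma lattice_distance_gap:
  obtains d where "d > 0"
    "\<And>x. x \<in> lattice_points \<Longrightarrow> dist c x < r \<Longrightarrow> dist c x \<le> r - d"
    "\<And>x. x \<in> lattice_points \<Longrightarrow> dist c x > r \<Longrightarrow> dist c x \<ge> r + d"
proof -
  \<comment> \<open>The extra element 1 makes \<open>D\<close> nonempty and accounts for the points
    beyond distance \<open>r + 1\<close>, which the finite image omits.\<close>
  define D where "D = insert 1 ((\<lambda>x. \<bar>dist c x - r\<bar>) ` {x \<in> lattice_points \<inter> cball c (r + 1). dist c x \<noteq> r})"
  have fin: "finite D"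
    unfolding D_def
    by (intro finite.insertI finite_imageI finite_subset[OF _ finite_lattice_cball[of c "r + 1"]]) auto
  have "Min D > 0"
    using fin by (subst Min_gr_iff) (auto simp: D_def)
  moreover have gap: "Min D \<le> \<bar>dist c x - r\<bar>" if "x \<in> lattice_points" "dist c x \<noteq> r" for x
  proof (cases "dist c x \<le> r + 1")
    case True
    then show ?thesis using that fin by (intro Min_le) (auto simp: D_def)
  next
    case False
    have "Min D \<le> 1" using fin by (intro Min_le) (auto simp: D_def)
    then show ?thesis using False by linarith
  qed
  have "dist c x \<le> r - Min D" if "x \<in> lattice_points" "dist c x < r" for x
    using gap[of x] that by linarith
  moreover have "dist c x \<ge> r + Min D" if "x \<in> lattice_points" "dist c x > r" for x
    using gap[of x] that by linarith
  ultimately show ?thesis using that by blast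
qed

lemma lattice_points_add: "x \<in> lattice_points \<Longrightarrow> y \<in> lattice_points \<Longrightarrow> x + y \<in> lattice_points"
  by (auto simp: lattice_points_def)

lemma lattice_points_diff: "x \<in> lattice_points \<Longrightarrow> y \<in> lattice_points \<Longrightarrow> x - y \<in> lattice_points"
  by (auto simp: lattice_points_def)

lemma
  assumes "v \<in> lattice_points"
  shows n_enclosing_translate: "n_enclosing n (c - v) r \<longleftrightarrow> n_enclosing n c r"
    and lattice_circle_translate: "lattice_circle (c - v) r \<longleftrightarrow> lattice_circle c r"
proof -
  \<comment> \<open>An arbitrary predicate \<open>P\<close> on distances treats interior and
    circumference at once.\<close>
  have eq: "card {x \<in> lattice_points. P (dist (c - v) x)} = card {x \<in> lattice_points. P (dist c x)}"
    for P :: "real \<Rightarrow> bool"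
  proof (rule bij_betw_same_card)
    show "bij_betw (\<lambda>x. x + v) {x \<in> lattice_points. P (dist (c - v) x)} {x \<in> lattice_points. P (dist c x)}"
      by (rule bij_betwI[where g = "\<lambda>x. x - v"])
        (auto simp: assms lattice_points_add lattice_points_diff dist_norm algebra_simps)
  qed
  have "lattice_points \<inter> ball a r = {x \<in> lattice_points. dist a x < r}"
    "lattice_points \<inter> sphere a r = {x \<in> lattice_points. dist a x = r}" for a
    by auto
  then show "n_enclosing n (c - v) r \<longleftrightarrow> n_enclosing n c r"
    "lattice_circle (c - v) r \<longleftrightarrow> lattice_circle c r"
    using eq[of "\<lambda>d. d < r"] eq[of "\<lambda>d. d = r"]
    by (simp_all add: n_enclosing_def lattice_circle_def)
qed

lemma obtain_lattice_translation:
  obtains v where "v \<in> lattice_points" "c - v \<in> {0..1} \<times> {0..1}"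
proof
  let ?v = "(of_int \<lfloor>fst c\<rfloor>, of_int \<lfloor>snd c\<rfloor>)"
  show "?v \<in> lattice_points" by (simp add: lattice_points_def)
  have "fst c - of_int \<lfloor>fst c\<rfloor> \<in> {0..1}" "snd c - of_int \<lfloor>snd c\<rfloor> \<in> {0..1}"
    by (simp_all, linarith+)
  then show "c - ?v \<in> {0..1} \<times> {0..1}"
    by (simp add: mem_Times_iff)
qed

section \<open>Boundedness of the radii for fixed n\<close>

lemma enclosing_radiiI: "n_enclosing n c r \<Longrightarrow> r \<in> enclosing_radii n"
  unfolding enclosing_radii_def by blast

lemma enclosing_radiiE:
  assumes "r \<in> enclosing_radii n"
  obtains c where "n_enclosing n c r"
  using assms unfolding enclosing_radii_def by blast

lemma enclosing_radius_pos: "r \<in> enclosing_radii n \<Longrightarrow> r > 0"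
  by (auto simp: enclosing_radii_def n_enclosing_def)

text \<open>A disk of radius above \<open>n + 2\<close> already contains \<open>n + 1\<close>
  consecutive lattice points of one row, starting at the lower left corner of the unit cell of the
  centre.\<close>

lemma enclosing_radius_le: "r \<in> enclosing_radii n \<Longrightarrow> r \<le> real n + 2"
proof (rule ccontr)
  assume "r \<in> enclosing_radii n" and *: "\<not> r \<le> real n + 2"
  then obtain c where c: "card (lattice_points \<inter> ball c r) = n"
    by (auto simp: enclosing_radii_def n_enclosing_def)
  let ?f = "\<lambda>i::nat. (real_of_int \<lfloor>fst c\<rfloor> + real i, real_of_int \<lfloor>snd c\<rfloor>)"
  have "?f ` {..n} \<subseteq> lattice_points \<inter> ball c r"
  proof (clarify)
    fix i :: nat assume i: "i \<le> n"
    have "dist c (?f i) \<le> \<bar>fst c - (real_of_int \<lfloor>fst c\<rfloor> + real i)\<bar> + \<bar>snd c - real_of_int \<lfloor>snd c\<rfloor>\<bar>"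
      using norm_Pair_le[of "fst c - (real_of_int \<lfloor>fst c\<rfloor> + real i)" "snd c - real_of_int \<lfloor>snd c\<rfloor>"]
      by (cases c) (simp add: dist_norm)
    also have "\<dots> \<le> (1 + real n) + 1"
    proof (rule add_mono)
      have "real i \<le> real n" using i by simp
      then show "\<bar>fst c - (real_of_int \<lfloor>fst c\<rfloor> + real i)\<bar> \<le> 1 + real n" by linarith
      show "\<bar>snd c - real_of_int \<lfloor>snd c\<rfloor>\<bar> \<le> 1" by linarith
    qed
    finally have "dist c (?f i) < r" using * by linarith
    then show "?f i \<in> lattice_points \<inter> ball c r"
      by (auto simp: lattice_points_def)
  qed
  then have "card (?f ` {..n}) \<le> n"
    using card_mono[OF finite_lattice_ball] c by metis
  moreover have "card (?f ` {..n}) = Suc n"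
    by (subst card_image) (auto simp: inj_on_def)
  ultimately show False by simp
qed

lemma bdd_above_enclosing_radii: "bdd_above (enclosing_radii n)"
  using enclosing_radius_le by (auto simp: bdd_above_def)

section \<open>Generic centres and admitting one more lattice point\<close>

lemma uncountable_open_interval_avoid:
  fixes a b :: real
  assumes "a < b" "countable S"
  obtains x where "a < x" "x < b" "x \<notin> S"
proof -
  have "\<not> {a<..<b} \<subseteq> S"
    using assms countable_subset uncountable_open_interval by blast
  then obtain x where "x \<in> {a<..<b}" "x \<notin> S" by blast
  then show ?thesis using that[of x] by simp
qed

text \<open>The second coordinate is chosen outside \<open>\<rat> + \<rat> x\<close>, so that the centre lies on no
  perpendicular bisector of two lattice points.\<close>
lemma obtain_generic_center:
  assumes "e > 0"
  obtains c' where "dist c c' < e" "inj_on (dist c') lattice_points"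
proof -
  obtain a b where c: "c = (a, b)" by (cases c)
  obtain x where x: "a < x" "x < a + e / 2" "x \<notin> \<rat>"
    using uncountable_open_interval_avoid[of a "a + e / 2" \<rat>] assms countable_rat by auto
  have "countable ((\<lambda>(s, t). s + t * x) ` (\<rat> \<times> \<rat>))"
    using countable_rat by (intro countable_image countable_SIGMA)
  then obtain y where y: "b < y" "y < b + e / 2" "y \<notin> (\<lambda>(s, t). s + t * x) ` (\<rat> \<times> \<rat>)"
    using uncountable_open_interval_avoid[of b "b + e / 2"] assms by auto
  have "dist c (x, y) \<le> \<bar>a - x\<bar> + \<bar>b - y\<bar>"
    using norm_Pair_le[of "a - x" "b - y"] by (simp add: c dist_norm)
  then have "dist c (x, y) < e" using x y by linarith
  moreover have "inj_on (dist (x, y)) lattice_points"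
  proof (rule inj_onI)
    fix p q assume pq: "p \<in> lattice_points" "q \<in> lattice_points" "dist (x, y) p = dist (x, y) q"
    obtain p1 p2 q1 q2 where e: "p = (p1, p2)" "q = (q1, q2)" by (cases p, cases q)
    have ints: "p1 \<in> \<int>" "p2 \<in> \<int>" "q1 \<in> \<int>" "q2 \<in> \<int>"
      using pq e by (auto simp: lattice_points_def)
    then have rats: "p1 \<in> \<rat>" "p2 \<in> \<rat>" "q1 \<in> \<rat>" "q2 \<in> \<rat>"
      using Ints_subset_Rats by auto
    have "(dist x p1)\<^sup>2 + (dist y p2)\<^sup>2 = (dist x q1)\<^sup>2 + (dist y q2)\<^sup>2"
      using pq(3) by (simp add: e dist_Pair_Pair)
    \<comment> \<open>The squares of \<open>x\<close> and \<open>y\<close> cancel, leaving a linear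
      relation with rational coefficients. The choice of \<open>y\<close> forces
      \<open>p2 = q2\<close>, and then irrationality of \<open>x\<close> forces
      \<open>p1 = q1\<close>.\<close>
    then have eq: "2 * (p2 - q2) * y = (p1\<^sup>2 + p2\<^sup>2 - q1\<^sup>2 - q2\<^sup>2) + 2 * (q1 - p1) * x"
      by (simp add: dist_real_def power2_eq_square algebra_simps)
    have "p2 = q2"
    proof (rule ccontr)
      assume ne: "p2 \<noteq> q2"
      define D where "D = 2 * (p2 - q2)"
      let ?s = "(p1\<^sup>2 + p2\<^sup>2 - q1\<^sup>2 - q2\<^sup>2) / D" and ?t = "2 * (q1 - p1) / D"
      have D: "D \<noteq> 0" "D \<in> \<rat>"
        using ne rats by (auto simp: D_def intro!: Rats_diff Rats_mult)
      have "y = D * y / D" using D by simp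
      also have "\<dots> = ?s + ?t * x"
        using eq by (simp add: D_def add_divide_distrib)
      finally have y_eq: "y = ?s + ?t * x" .
      have "?s \<in> \<rat>" "?t \<in> \<rat>"
        using rats D by (auto intro!: Rats_divide Rats_diff Rats_add Rats_mult Rats_power)
      then have "(\<lambda>(s, t). s + t * x) (?s, ?t) \<in> (\<lambda>(s, t). s + t * x) ` (\<rat> \<times> \<rat>)"
        by (intro imageI) simp
      then show False using y(3) y_eq by (metis case_prod_conv)
    qed
    moreover have "p1 = q1"
    proof (rule ccontr)
      assume ne: "p1 \<noteq> q1"
      have "x = (p1\<^sup>2 - q1\<^sup>2) / (2 * (p1 - q1))"
        using ne eq \<open>p2 = q2\<close> by (simp add: eq_divide_eq algebra_simps)
      moreover have "(p1\<^sup>2 - q1\<^sup>2) / (2 * (p1 - q1)) \<in> \<rat>"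
        using rats by (auto intro!: Rats_divide Rats_diff Rats_mult Rats_power)
      ultimately show False using x(3) by simp
    qed
    ultimately show "p = q" by (simp add: e)
  qed
  ultimately show ?thesis using that by blast
qed

text \<open>Since distances from \<open>c\<close> are distinct, the nearest lattice point not
  enclosed is unique; a radius slightly beyond it gains this point only.\<close>

lemma n_enclosing_Suc_generic:
  assumes "n_enclosing n c r" "inj_on (dist c) lattice_points"
  obtains s where "s > r" "n_enclosing (Suc n) c s"
proof -
  let ?B = "\<lambda>r. lattice_points \<inter> ball c r"
  have r: "r > 0" and card: "card (?B r) = n"
    using assms(1) by (auto simp: n_enclosing_def)
  \<comment> \<open>The cutoff makes \<open>O'\<close> finite. It exceeds the bound
    \<open>n + 2\<close>, so a disk of this radius cannot enclose only \<open>n\<close> points and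
    \<open>O'\<close> is nonempty.\<close>
  define O' where "O' = {x \<in> ?B (real n + 4). r \<le> dist c x}"
  have "O' \<noteq> {}"
  proof
    assume "O' = {}"
    then have "?B (real n + 4) \<subseteq> ?B r" by (auto simp: O'_def not_le)
    then have "card (?B (real n + 4)) \<le> n"
      using card_mono[OF finite_lattice_ball, of _ c r] card by auto
    moreover have "real n + 4 \<in> enclosing_radii (card (?B (real n + 4)))"
      by (rule enclosing_radiiI[of _ c]) (simp add: n_enclosing_def)
    ultimately show False
      using enclosing_radius_le by fastforce
  qed
  moreover have finO: "finite O'"
    unfolding O'_def by (rule finite_subset[OF _ finite_lattice_ball]) blast
  ultimately obtain p where p: "p \<in> O'" "\<And>x. x \<in> O' \<Longrightarrow> dist c p \<le> dist c x"
    using ex_min_if_finite[of "dist c ` O'"] by (auto simp: not_less)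
  obtain d where d: "d > 0"
    "\<And>x. x \<in> lattice_points \<Longrightarrow> dist c x > dist c p \<Longrightarrow> dist c x \<ge> dist c p + d"
    using lattice_distance_gap[of c "dist c p"] by metis
  have pl: "p \<in> lattice_points" "r \<le> dist c p" "dist c p < real n + 4"
    using p(1) by (auto simp: O'_def)
  have "?B (dist c p + d) = insert p (?B r)"
  proof (intro equalityI subsetI)
    fix x assume x: "x \<in> ?B (dist c p + d)"
    then have le: "dist c x \<le> dist c p" using d(2)[of x] by force
    show "x \<in> insert p (?B r)"
    proof (cases "r \<le> dist c x")
      case True
      then have "x \<in> O'" using x le pl(3) by (auto simp: O'_def)
      then have "dist c x = dist c p" using p(2) le antisym by blast
      then show ?thesis using x pl(1) assms(2) by (auto dest: inj_onD)
    next
      case False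
      then show ?thesis using x by auto
    qed
  qed (use d(1) pl in auto)
  moreover have "p \<notin> ?B r" using pl by auto
  ultimately have "card (?B (dist c p + d)) = Suc n"
    using finite_lattice_ball card by simp
  then have "n_enclosing (Suc n) c (dist c p + d)"
    using d(1) pl r by (auto simp: n_enclosing_def)
  then show ?thesis using that[of "dist c p + d"] d(1) pl(2) by simp
qed

lemma enclosing_radius_Suc_approx:
  assumes "r \<in> enclosing_radii n" "e > 0"
  obtains s where "s \<in> enclosing_radii (Suc n)" "s > r - e"
proof -
  obtain c where c: "r > 0" "card (lattice_points \<inter> ball c r) = n"
    using enclosing_radiiE[OF assms(1)] unfolding n_enclosing_def by metis
  obtain d where d: "d > 0"
    "\<And>x. x \<in> lattice_points \<Longrightarrow> dist c x < r \<Longrightarrow> dist c x \<le> r - d"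
    using lattice_distance_gap[of c r] by metis
  \<comment> \<open>Radius loss and displacement are both controlled by \<open>h\<close>. A point
    within \<open>r - d\<close> of \<open>c\<close> is within
    \<open>r - d + h \<le> r - 2 * h\<close> of \<open>c'\<close>, so it stays enclosed;
    \<open>h < r\<close> keeps the radius positive and \<open>h < e\<close> bounds the loss.\<close>
  define h where "h = min (min (d / 3) (e / 2)) (r / 2)"
  have h: "h > 0" "3 * h \<le> d" "h < e" "h < r"
    using d(1) c(1) assms(2) by (auto simp: h_def)
  obtain c' where c': "dist c c' < h" "inj_on (dist c') lattice_points"
    using obtain_generic_center[OF h(1)] by metis
  have "lattice_points \<inter> ball c' (r - h) = lattice_points \<inter> ball c r"
  proof (intro equalityI subsetI)
    fix x assume "x \<in> lattice_points \<inter> ball c' (r - h)"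
    then show "x \<in> lattice_points \<inter> ball c r"
      using c'(1) dist_triangle[of c x c'] by auto
  next
    fix x assume x: "x \<in> lattice_points \<inter> ball c r"
    then have "dist c x \<le> r - d" using d(2) by auto
    then show "x \<in> lattice_points \<inter> ball c' (r - h)"
      using x c'(1) h dist_triangle[of c' x c] by (auto simp: dist_commute[of c' c])
  qed
  then have "n_enclosing n c' (r - h)"
    using c h by (simp add: n_enclosing_def)
  then obtain s where "s > r - h" "n_enclosing (Suc n) c' s"
    using n_enclosing_Suc_generic[OF _ c'(2)] by blast
  then show ?thesis using that[OF enclosing_radiiI, of c' s] h by linarith
qed

lemma enclosing_radii_nonempty: "enclosing_radii n \<noteq> {}"
proof (induction n)
  case 0
  \<comment> \<open>The open disk with diameter from (0,0) to (1,0) lies strictly between two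
    lattice columns.\<close>
  let ?c = "(1/2, 0) :: real \<times> real"
  have "lattice_points \<inter> ball ?c (1/2) = {}"
  proof (intro equals0I)
    fix x assume x: "x \<in> lattice_points \<inter> ball ?c (1/2)"
    then have "dist (1/2) (fst x) < 1/2"
      using dist_fst_le[of ?c x] by auto
    moreover obtain k where "fst x = of_int k"
      using x by (auto simp: lattice_points_def elim!: Ints_cases)
    ultimately have "0 < real_of_int k" "real_of_int k < 1" by (auto simp: dist_real_def abs_if split: if_splits)
    then show False by simp
  qed
  then have "n_enclosing 0 ?c (1/2)" by (simp add: n_enclosing_def)
  then show ?case using enclosing_radiiI by blast
next
  case (Suc n)
  then obtain r where "r \<in> enclosing_radii n" by auto
  then show ?case using enclosing_radius_Suc_approx[of r n 1] by auto
qed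

section \<open>Suprema of radii, monotonicity and limits of circles\<close>

lemma MC_radius_attained: "MC n \<Longrightarrow> R n \<in> enclosing_radii n"
  and R_eq_Sup: "R n = Sup (enclosing_radii n)"
proof -
  have *: "R n = r \<and> Sup (enclosing_radii n) = r"
    if "MC n" "r \<in> enclosing_radii n" "\<And>s. s \<in> enclosing_radii n \<Longrightarrow> s \<le> r" for r
  proof -
    have "MC_radius n = r"
      unfolding MC_radius_def using that by (intro Greatest_equality)
    moreover have "Sup (enclosing_radii n) = r"
      using that by (intro cSup_eq_maximum)
    ultimately show ?thesis using that by (simp add: R_def)
  qed
  show "MC n \<Longrightarrow> R n \<in> enclosing_radii n"
    using * unfolding MC_def by metis
  show "R n = Sup (enclosing_radii n)"
  proof (cases "MC n")
    case True
    then show ?thesis using * unfolding MC_def by metis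
  qed (simp add: R_def LUBOR_def)
qed

lemma enclosing_radius_le_R: "r \<in> enclosing_radii n \<Longrightarrow> r \<le> R n"
  unfolding R_eq_Sup by (rule cSup_upper[OF _ bdd_above_enclosing_radii])

lemma R_pos: "R n > 0"
  using enclosing_radii_nonempty[of n] enclosing_radius_pos enclosing_radius_le_R by fastforce

lemma incseq_R: "incseq R"
proof (rule incseq_SucI)
  fix n
  show "R n \<le> R (Suc n)"
    unfolding R_eq_Sup[of n]
  proof (rule cSup_least[OF enclosing_radii_nonempty])
    fix r assume r: "r \<in> enclosing_radii n"
    show "r \<le> R (Suc n)"
    proof (rule field_le_epsilon)
      fix e :: real assume "e > 0"
      then obtain s where "s \<in> enclosing_radii (Suc n)" "s > r - e"
        using enclosing_radius_Suc_approx r by blast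
      then show "r \<le> R (Suc n) + e" using enclosing_radius_le_R by fastforce
    qed
  qed
qed

text \<open>Being strictly inside the limit circle is an open condition, so the finitely many points
  enclosed by the limit are all enclosed by some circle of the sequence. Points may escape to the
  circumference in the limit, hence only \<open>m \<le> n\<close>.\<close>

lemma R_enclosing_fewer:
  obtains m where "m \<le> n" "R n \<in> enclosing_radii m"
proof -
  have "R n \<in> closure (enclosing_radii n)"
    unfolding R_eq_Sup
    by (rule closure_contains_Sup[OF enclosing_radii_nonempty bdd_above_enclosing_radii])
  then obtain r where r: "\<And>j. r j \<in> enclosing_radii n" "r \<longlonglongrightarrow> R n"
    by (auto simp: closure_sequential)
  have "\<exists>c. n_enclosing n c (r j) \<and> c \<in> {0..1} \<times> {0..1}" for j
  proof -
    obtain c where "n_enclosing n c (r j)" using r(1) by (rule enclosing_radiiE)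
    then show ?thesis
      using obtain_lattice_translation[of c] n_enclosing_translate[of _ n c "r j"] by metis
  qed
  then obtain c where c: "\<And>j. n_enclosing n (c j) (r j)" "\<And>j. c j \<in> {0..1} \<times> {0..1}"
    by metis
  have "compact ({0..1::real} \<times> {0..1::real})"
    by (intro compact_Times compact_Icc)
  then obtain l f where lf: "strict_mono f" "(c \<circ> f) \<longlonglongrightarrow> l"
    using c(2) unfolding compact_def by metis
  have rf: "(r \<circ> f) \<longlonglongrightarrow> R n"
    using r(2) lf(1) by (rule LIMSEQ_subseq_LIMSEQ)
  let ?S = "lattice_points \<inter> ball l (R n)"
  have "\<forall>x\<in>?S. \<forall>\<^sub>F j in sequentially. dist ((c \<circ> f) j) x < (r \<circ> f) j"
  proof
    fix x assume "x \<in> ?S"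
    then have "dist l x < R n" by simp
    moreover have "(\<lambda>j. (r \<circ> f) j - dist ((c \<circ> f) j) x) \<longlonglongrightarrow> R n - dist l x"
      by (intro tendsto_intros rf lf)
    ultimately have "\<forall>\<^sub>F j in sequentially. 0 < (r \<circ> f) j - dist ((c \<circ> f) j) x"
      by (intro order_tendstoD) auto
    then show "\<forall>\<^sub>F j in sequentially. dist ((c \<circ> f) j) x < (r \<circ> f) j"
      by eventually_elim simp
  qed
  then have "\<forall>\<^sub>F j in sequentially. \<forall>x\<in>?S. dist ((c \<circ> f) j) x < (r \<circ> f) j"
    by (rule eventually_ball_finite[OF finite_lattice_ball])
  then obtain j where "\<forall>x\<in>?S. dist ((c \<circ> f) j) x < (r \<circ> f) j"
    using eventually_happens' sequentially_bot by blast
  then have "?S \<subseteq> lattice_points \<inter> ball (c (f j)) (r (f j))" by auto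
  then have "card ?S \<le> n"
    using card_mono[OF finite_lattice_ball] c(1)[of "f j"] unfolding n_enclosing_def by metis
  moreover have "R n \<in> enclosing_radii (card ?S)"
    by (rule enclosing_radiiI[of _ l]) (simp add: n_enclosing_def R_pos)
  ultimately show ?thesis using that by blast
qed

lemma R_attained_imp_MC: "R n \<in> enclosing_radii n \<Longrightarrow> MC n"
  using enclosing_radius_le_R unfolding MC_def by blast

text \<open>The limit circle of radius \<open>R (Suc n)\<close> cannot enclose \<open>Suc n\<close>
  points, as the supremum would then be attained. It encloses some \<open>m \<le> n\<close>, so
  \<open>R (Suc n) \<le> R m \<le> R n\<close>.\<close>

lemma R_Suc_non_MC:
  assumes "\<not> MC (Suc n)"
  shows "R (Suc n) = R n"
proof (rule antisym)
  obtain m where m: "m \<le> Suc n" "R (Suc n) \<in> enclosing_radii m"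
    using R_enclosing_fewer by blast
  then have "m \<le> n" using assms R_attained_imp_MC by (metis le_Suc_eq)
  then show "R (Suc n) \<le> R n"
    using enclosing_radius_le_R[OF m(2)] incseqD[OF incseq_R] order_trans by blast
qed (use incseq_SucD[OF incseq_R] in auto)

lemma R_eq_of_non_MC:
  assumes "k \<le> n" "\<And>m. k < m \<Longrightarrow> m \<le> n \<Longrightarrow> \<not> MC m"
  shows "R n = R k"
  using assms by (induction n rule: dec_induct) (auto simp: R_Suc_non_MC)

section \<open>Enlarging circles that are not lattice circles\<close>

lemma enlarge_n_enclosing:
  assumes "n_enclosing n c r" "\<not> lattice_circle c r"
  obtains s where "s > r" "s \<in> enclosing_radii n"
proof -
  let ?S = "lattice_points \<inter> sphere c r"
  have r: "r > 0" and card: "card (lattice_points \<inter> ball c r) = n"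
    using assms(1) by (auto simp: n_enclosing_def)
  have "card ?S < 3" using assms(2) r by (auto simp: lattice_circle_def)
  then have "card ?S = 0 \<or> card ?S = 1 \<or> card ?S = 2" by linarith
  \<comment> \<open>With fewer than two lattice points on the circumference, \<open>p = q\<close> is
    allowed, and with none an arbitrary point of the circle serves, so one construction covers all
    cases.\<close>
  then obtain p q where pq: "?S \<subseteq> {p, q}" "dist c p = r" "dist c q = r"
  proof (elim disjE)
    assume "card ?S = 0"
    then have "?S = {}" using finite_lattice_sphere by auto
    moreover have "dist c (c + (r, 0)) = r"
      using r by (simp add: dist_norm norm_Pair)
    ultimately show ?thesis using that[of "c + (r, 0)" "c + (r, 0)"] by auto
  next
    assume "card ?S = 1"
    then obtain p where S: "?S = {p}" by (auto simp: card_1_singleton_iff)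
    then have "p \<in> ?S" by blast
    then show ?thesis using S by (intro that[of p p]) auto
  next
    assume "card ?S = 2"
    then obtain p q where S: "?S = {p, q}" by (auto simp: card_2_iff)
    then have "p \<in> ?S" "q \<in> ?S" by blast+
    then show ?thesis using S by (intro that[of p q]) auto
  qed
  have "\<exists>u. u \<noteq> 0 \<and> u \<bullet> (p - q) = 0"
  proof (cases "p = q")
    case True
    then show ?thesis by (intro exI[of _ "(1, 0)"]) (simp add: zero_prod_def)
  next
    case False
    then show ?thesis
      by (intro exI[of _ "(- snd (p - q), fst (p - q))"])
        (auto simp: zero_prod_def prod_eq_iff inner_prod_def algebra_simps)
  qed
  then obtain u0 where u0: "u0 \<noteq> 0" "u0 \<bullet> (p - q) = 0" by blast
  \<comment> \<open>Either sign keeps the centre equidistant from \<open>p\<close> and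
    \<open>q\<close>; this one makes the linear term of \<open>sq\<close> nonnegative at
    \<open>p\<close>, so the radius grows.\<close>
  define u where "u = (if u0 \<bullet> (c - p) \<ge> 0 then u0 else - u0)"
  have u: "u \<noteq> 0" "u \<bullet> (p - q) = 0" "u \<bullet> (c - p) \<ge> 0"
    using u0 by (auto simp: u_def)
  obtain d where d: "d > 0"
    "\<And>x. x \<in> lattice_points \<Longrightarrow> dist c x < r \<Longrightarrow> dist c x \<le> r - d"
    "\<And>x. x \<in> lattice_points \<Longrightarrow> dist c x > r \<Longrightarrow> dist c x \<ge> r + d"
    using lattice_distance_gap[of c r] by metis
  \<comment> \<open>The centre moves by \<open>d / 3\<close> and the radius grows by at most
    \<open>d / 3\<close>. The total stays below the gap \<open>d\<close>, so no point outside the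
    old circle is captured and no enclosed point is lost.\<close>
  define t where "t = d / (3 * norm u)"
  have t: "t > 0" "t * norm u = d / 3" using d(1) u(1) by (auto simp: t_def)
  define c' where "c' = c + t *\<^sub>R u"
  define s where "s = dist c' p"
  have cc': "dist c c' = d / 3" using t by (simp add: c'_def dist_norm)
  have sq: "(dist c' x)\<^sup>2 = (dist c x)\<^sup>2 + 2 * t * (u \<bullet> (c - x)) + (t * norm u)\<^sup>2" for x
    unfolding dist_norm power2_norm_eq_inner c'_def power_mult_distrib
    by (simp add: algebra_simps inner_commute power2_eq_square)
  have "u \<bullet> (c - q) = u \<bullet> (c - p)"
    using u(2) by (simp add: inner_diff_right)
  then have "(dist c' q)\<^sup>2 = (dist c' p)\<^sup>2" by (simp add: sq pq)
  then have sq': "dist c' q = s" by (simp add: s_def)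
  have "0 < (t * norm u)\<^sup>2" using t(1) u(1) by simp
  moreover have "0 \<le> 2 * t * (u \<bullet> (c - p))" using t u by simp
  ultimately have "r\<^sup>2 < s\<^sup>2" using sq[of p] unfolding s_def pq by linarith
  then have s: "r < s" by (rule power2_less_imp_less) (simp add: s_def)
  have s_le: "s \<le> r + d / 3"
    using dist_triangle[of c' p c] cc' pq by (simp add: s_def dist_commute[of c' c])
  have "lattice_points \<inter> ball c' s = lattice_points \<inter> ball c r"
  proof (intro equalityI subsetI)
    fix x assume x: "x \<in> lattice_points \<inter> ball c' s"
    have "dist c x < r + d"
      using x s_le cc' d(1) dist_triangle[of c x c'] by auto
    then have "dist c x \<le> r" using d(3)[of x] x by fastforce
    \<comment> \<open>Lattice points of the old circumference are among \<open>p\<close> and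
      \<open>q\<close>, which lie on the new circumference and so are not enclosed.\<close>
    moreover have "dist c x \<noteq> r"
    proof
      assume "dist c x = r"
      then have "x = p \<or> x = q" using x pq(1) by auto
      then show False using x sq' by (auto simp: s_def)
    qed
    ultimately show "x \<in> lattice_points \<inter> ball c r" using x by auto
  next
    fix x assume x: "x \<in> lattice_points \<inter> ball c r"
    then have "dist c x \<le> r - d" using d(2) by auto
    then have "dist c' x < r"
      using cc' d(1) dist_triangle[of c' x c] by (simp add: dist_commute[of c' c])
    then show "x \<in> lattice_points \<inter> ball c' s" using x s by auto
  qed
  then have "n_enclosing n c' s" using s r card by (simp add: n_enclosing_def)
  then show ?thesis using that[of s] s by (auto intro: enclosing_radiiI)
qed

lemma MC_radius_lattice_circle:
  assumes "MC n"
  shows "R n \<in> lattice_circle_radii n"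
proof -
  obtain c where c: "n_enclosing n c (R n)"
    using MC_radius_attained[OF assms] by (rule enclosing_radiiE)
  have "lattice_circle c (R n)"
    using enlarge_n_enclosing[OF c] enclosing_radius_le_R leD by metis
  with c show ?thesis unfolding lattice_circle_radii_def by blast
qed

section \<open>Finiteness of lattice circle radii\<close>

text \<open>Common points of two circles with distinct centres lie on their radical axis, and a line
  meets a circle at most twice.\<close>

lemma spheres_eq_if_three_common_points:
  fixes c c' :: "real \<times> real"
  assumes dist: "dist c p = r" "dist c q = r" "dist c s = r"
    "dist c' p = r'" "dist c' q = r'" "dist c' s = r'"
    and ne: "p \<noteq> q" "p \<noteq> s" "q \<noteq> s"
  shows "c = c'"
proof (rule ccontr)
  assume "c \<noteq> c'"
  obtain a b a' b' p1 p2 q1 q2 s1 s2 where e: "c = (a, b)" "c' = (a', b')"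
    "p = (p1, p2)" "q = (q1, q2)" "s = (s1, s2)"
    by (cases c, cases c', cases p, cases q, cases s)
  have d: "(dist (x, y) (z, w))\<^sup>2 = (x - z)\<^sup>2 + (y - w)\<^sup>2" for x y z w :: real
    by (simp add: dist_Pair_Pair dist_real_def)
  define x y u v where "x = q1 - p1" and "y = q2 - p2" and "u = s1 - p1" and "v = s2 - p2"
  define A B where "A = a' - a" and "B = b' - b"
  note defs = x_def y_def u_def v_def A_def B_def
  have *: "(a - p1)\<^sup>2 + (b - p2)\<^sup>2 = r\<^sup>2" "(a - q1)\<^sup>2 + (b - q2)\<^sup>2 = r\<^sup>2" "(a - s1)\<^sup>2 + (b - s2)\<^sup>2 = r\<^sup>2"
    "(a' - p1)\<^sup>2 + (b' - p2)\<^sup>2 = r'\<^sup>2" "(a' - q1)\<^sup>2 + (b' - q2)\<^sup>2 = r'\<^sup>2" "(a' - s1)\<^sup>2 + (b' - s2)\<^sup>2 = r'\<^sup>2"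
    using dist d[of a b p1 p2] d[of a b q1 q2] d[of a b s1 s2]
      d[of a' b' p1 p2] d[of a' b' q1 q2] d[of a' b' s1 s2] unfolding e by auto
  \<comment> \<open>Subtracting the circle equations shows that \<open>q - p\<close> and
    \<open>s - p\<close> are orthogonal to \<open>c' - c = (A, B)\<close>.\<close>
  have 1: "A * x + B * y = 0" "A * u + B * v = 0"
    using * unfolding defs power2_eq_square by (simp_all add: algebra_simps)
  have AB: "A\<^sup>2 + B\<^sup>2 \<noteq> 0" using \<open>c \<noteq> c'\<close> by (auto simp: e defs sum_power2_eq_zero_iff)
  text \<open>The line through \<open>p\<close> with direction \<open>(-B, A)\<close> contains \<open>q\<close> and \<open>s\<close>, at parameters \<open>k\<close> and
    \<open>l\<close>, but meets the circle in at most one point besides \<open>p\<close>.\<close>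
  define k l where "k = (A * y - B * x) / (A\<^sup>2 + B\<^sup>2)" and "l = (A * v - B * u) / (A\<^sup>2 + B\<^sup>2)"
  have "x * (A\<^sup>2 + B\<^sup>2) = - B * (A * y - B * x)" "y * (A\<^sup>2 + B\<^sup>2) = A * (A * y - B * x)"
    "u * (A\<^sup>2 + B\<^sup>2) = - B * (A * v - B * u)" "v * (A\<^sup>2 + B\<^sup>2) = A * (A * v - B * u)"
    using 1 by algebra+
  then have xy: "x = - B * k" "y = A * k" "u = - B * l" "v = A * l"
    using AB by (simp_all add: k_def l_def field_simps)
  \<comment> \<open>On this line the circle equation reads
    \<open>k * ((A\<^sup>2 + B\<^sup>2) * k - w) = 0\<close>, with root 0 at \<open>p\<close> and a
    single other candidate.\<close>
  define w where "w = 2 * (A * (b - p2) - B * (a - p1))"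
  have "x\<^sup>2 + y\<^sup>2 = 2 * (x * (a - p1) + y * (b - p2))" "u\<^sup>2 + v\<^sup>2 = 2 * (u * (a - p1) + v * (b - p2))"
    using * unfolding x_def y_def u_def v_def power2_eq_square by (simp_all add: algebra_simps)
  then have "k * ((A\<^sup>2 + B\<^sup>2) * k - w) = 0" "l * ((A\<^sup>2 + B\<^sup>2) * l - w) = 0"
    unfolding xy w_def by (simp_all add: power2_eq_square algebra_simps)
  moreover have "k \<noteq> 0" "l \<noteq> 0" "k \<noteq> l"
    using ne xy by (auto simp: e defs)
  ultimately have "(A\<^sup>2 + B\<^sup>2) * k = (A\<^sup>2 + B\<^sup>2) * l" by simp
  then show False using AB \<open>k \<noteq> l\<close> by simp
qed

text \<open>Translate the centre into the unit square. A lattice circle is determined by its set of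
  circumference points, and these sets are subsets of one finite set. Hence a largest radius exists
  whenever there is any.\<close>

lemma finite_lattice_circle_radii: "finite (lattice_circle_radii n)"
proof -
  define C where "C = {(c, r). c \<in> {0..1} \<times> {0..1} \<and>
    n_enclosing n c r \<and> lattice_circle c r}"
  let ?f = "\<lambda>(c, r). lattice_points \<inter> sphere c r"
  have "inj_on ?f C"
  proof (rule inj_onI, clarsimp simp del: Int_iff)
    fix a b r a' b' r'
    assume C: "((a, b), r) \<in> C" "((a', b'), r') \<in> C"
      and eq: "lattice_points \<inter> sphere (a, b) r = lattice_points \<inter> sphere (a', b') r'"
    have "3 \<le> card (lattice_points \<inter> sphere (a, b) r)"
      using C by (auto simp: C_def lattice_circle_def)
    then obtain T where "T \<subseteq> lattice_points \<inter> sphere (a, b) r" "card T = 3"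
      using obtain_subset_with_card_n by metis
    then obtain p q s where pqs: "{p, q, s} \<subseteq> lattice_points \<inter> sphere (a, b) r"
      "p \<noteq> q" "p \<noteq> s" "q \<noteq> s"
      by (auto simp: card_3_iff)
    then have "{p, q, s} \<subseteq> lattice_points \<inter> sphere (a', b') r'" using eq by simp
    with pqs have *: "dist (a, b) p = r" "dist (a, b) q = r" "dist (a, b) s = r"
      "dist (a', b') p = r'" "dist (a', b') q = r'" "dist (a', b') s = r'"
      by auto
    have "(a, b) = (a', b')"
      by (rule spheres_eq_if_three_common_points[OF * pqs(2-4)])
    then show "a = a' \<and> b = b' \<and> r = r'" using * by auto
  qed
  \<comment> \<open>The radius is at most \<open>n + 2\<close> and the centre is within 2 of the
    origin.\<close>
  moreover have "?f ` C \<subseteq> Pow (lattice_points \<inter> cball 0 (real n + 4))"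
  proof -
    have "dist 0 x \<le> real n + 4" if C: "(c, r) \<in> C" and x: "dist c x = r" for c r x
    proof -
      have "n_enclosing n c r" using C by (simp add: C_def)
      then have "r \<le> real n + 2"
        using enclosing_radiiI enclosing_radius_le by blast
      moreover obtain a b where ab: "c = (a, b)" "\<bar>a\<bar> \<le> 1" "\<bar>b\<bar> \<le> 1"
        using C by (cases c) (auto simp: C_def)
      have "dist 0 c \<le> 2"
        using norm_Pair_le[of a b] ab by simp
      ultimately show ?thesis
        using x dist_triangle[of 0 x c] by linarith
    qed
    then show ?thesis by fastforce
  qed
  moreover have "finite (Pow (lattice_points \<inter> cball (0 :: real \<times> real) (real n + 4)))"
    using finite_lattice_cball by (simp del: Pow_Int_eq)
  ultimately have "finite C" using finite_imageD finite_subset by blast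
  moreover have "lattice_circle_radii n \<subseteq> snd ` C"
  proof
    fix r assume "r \<in> lattice_circle_radii n"
    then obtain c where "n_enclosing n c r" "lattice_circle c r"
      unfolding lattice_circle_radii_def by blast
    moreover obtain v where "v \<in> lattice_points" "c - v \<in> {0..1} \<times> {0..1}"
      using obtain_lattice_translation by blast
    ultimately have "(c - v, r) \<in> C"
      by (simp add: C_def n_enclosing_translate lattice_circle_translate)
    then show "r \<in> snd ` C" by force
  qed
  ultimately show ?thesis using finite_surj by blast
qed

lemma largest_lattice_circle_radius_eq_Max:
  assumes "lattice_circle_radii n \<noteq> {}"
  shows "largest_lattice_circle_radius n = Max (lattice_circle_radii n)"
proof -
  have "(GREATEST r. r \<in> lattice_circle_radii n) = Max (lattice_circle_radii n)"
    using assms finite_lattice_circle_radii by (intro Greatest_equality) auto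
  then show ?thesis using assms by (simp add: largest_lattice_circle_radius_def)
qed

text \<open>A largest lattice circle radius is itself an \<open>n\<close>-enclosing radius; equality
  with \<open>R n\<close> would make \<open>n\<close> MC. If there is none, the default 0 lies below
  the positive \<open>R n\<close>.\<close>

lemma largest_lattice_circle_radius_less_R:
  assumes "\<not> MC n"
  shows "largest_lattice_circle_radius n < R n"
proof (cases "lattice_circle_radii n = {}")
  case True
  then show ?thesis using R_pos by (simp add: largest_lattice_circle_radius_def)
next
  case False
  then have "largest_lattice_circle_radius n \<in> lattice_circle_radii n"
    using finite_lattice_circle_radii by (simp add: largest_lattice_circle_radius_eq_Max)
  then have "largest_lattice_circle_radius n \<in> enclosing_radii n"
    unfolding lattice_circle_radii_def enclosing_radii_def by blast
  then show ?thesis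
    using assms enclosing_radius_le_R R_attained_imp_MC by (metis order_le_less)
qed

lemma R_le_largest_lattice_circle_radius:
  assumes "MC n"
  shows "R n \<le> largest_lattice_circle_radius n"
  using MC_radius_lattice_circle[OF assms] finite_lattice_circle_radii
  by (subst largest_lattice_circle_radius_eq_Max) auto

theorem theorem1p4:
  shows "(\<forall>n. R n > 0) \<and>
    incseq R \<and>
    (\<forall>k l n. consecutive_MC k l \<and> \<not> MC n \<and> k < n \<and> n < l \<longrightarrow>
       R n = R k \<and> LUBOR n = R k) \<and>
    (\<forall>k n. k < n \<and> MC k \<and> (\<forall>m. k < m \<and> m < n \<longrightarrow> \<not> MC m) \<longrightarrow>
       (largest_lattice_circle_radius n < R k \<longleftrightarrow> \<not> MC n))"
proof (intro conjI allI impI)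
  fix k l n
  assume *: "consecutive_MC k l \<and> \<not> MC n \<and> k < n \<and> n < l"
  then show "R n = R k"
    by (intro R_eq_of_non_MC) (auto simp: consecutive_MC_def)
  then show "LUBOR n = R k" using * by (simp add: R_def)
next
  fix k n
  assume *: "k < n \<and> MC k \<and> (\<forall>m. k < m \<and> m < n \<longrightarrow> \<not> MC m)"
  show "largest_lattice_circle_radius n < R k \<longleftrightarrow> \<not> MC n"
  proof
    assume "largest_lattice_circle_radius n < R k"
    \<comment> \<open>If \<open>n\<close> were MC, the largest lattice circle radius would be at
      least \<open>R n\<close>, hence at least \<open>R k\<close>.\<close>
    moreover have "R k \<le> R n" using * incseqD[OF incseq_R, of k n] by simp
    ultimately show "\<not> MC n" using R_le_largest_lattice_circle_radius[of n] by linarith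
  next
    assume n: "\<not> MC n"
    \<comment> \<open>The assumption on the numbers between stops before \<open>n\<close>;
      \<open>\<not> MC n\<close> supplies the endpoint.\<close>
    then have "R n = R k"
      using * by (intro R_eq_of_non_MC) (auto simp: order_le_less)
    then show "largest_lattice_circle_radius n < R k"
      using largest_lattice_circle_radius_less_R[OF n] by simp
  qed
qed (simp_all add: R_pos incseq_R)

end
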